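(* Let $\Gamma=\langle\alpha_1,\ldots,\alpha_k\rangle\subset\mathbb N^d$ be an affine semigroup and fix $i\le k$. Then $$\mathsf t_i(\Gamma)=\sup\{\mathsf t_i(\gamma):\gamma\in M_i\},$$ where $M_i=\{\varphi_\Gamma(x): x\in\mathrm{Minimals}_\le\mathsf Z(\alpha_i+\Gamma)\}$.
   Context: An affine semigroup is a finitely generated submonoid of $\mathbb N^d$ with minimal generating set $\alpha_1,\ldots,\alpha_k$; $\varphi_\Gamma(z)=z_1\alpha_1+\cdots+z_k\alpha_k$ for $z\in\mathbb N^k$, $\mathsf Z(\gamma)=\varphi_\Gamma^{-1}(\gamma)$, $|z|=z_1+\cdots+z_k$. For $z,w\in\mathbb N^k$, $\gcd(z,w)=(\min(z_l,w_l))_l$ and $\mathrm{dist}(z,w)=\max(|z-\gcd(z,w)|,|w-\gcd(z,w)|)$. For $\gamma\in\Gamma$ with $\gamma-\alpha_i\in\Gamma$, $\mathsf t_i(\gamma)$ is the least $N\in\mathbb N\cup\{\infty\}$ such that for every $z\in\mathsf Z(\gamma)$ there is $w\in\mathsf Z(\gamma)$ with $w_i>0$ and $\mathrm{dist}(z,w)\le N$; and $\mathsf t_i(\Gamma)=\sup\{\mathsf t_i(\gamma):\gamma-\alpha_i\in\Gamma\}$. $\alpha_i+\Gamma=\{\alpha_i+\beta:\beta\in\Gamma\}$, $\mathsf Z(\alpha_i+\Gamma)=\bigcup_{\gamma\in\alpha_i+\Gamma}\mathsf Z(\gamma)$, and $\mathrm{Minimals}_\le$ denotes the set of minimal elements with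 respect to the componentwise partial order $\le$ on $\mathbb N^k$. *)

theory Defs
  imports "HOL-Analysis.Analysis" "HOL-Library.Extended_Nat"
begin

definition is_submonoid :: "'a::comm_monoid_add set \<Rightarrow> bool" where
  "is_submonoid S \<longleftrightarrow> 0 \<in> S \<and> (\<forall>x\<in>S. \<forall>y\<in>S. x + y \<in> S)"

text \<open>
  The dimension \<open>d\<close> and the number \<open>k\<close> of generators are the cardinalities of the finite index
  types \<open>'d\<close> and \<open>'k\<close>; injectivity says that the listed generators are distinct.
\<close>

definition affine_semigroup :: "(nat ^ 'd) set \<Rightarrow> ('k::finite \<Rightarrow> nat ^ 'd) \<Rightarrow> bool" where
  "affine_semigroup \<Gamma> \<alpha> \<longleftrightarrow>
     inj \<alpha> \<and> \<Gamma> = is_submonoid hull range \<alpha> \<and>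
     (\<forall>S. S \<subset> range \<alpha> \<longrightarrow> is_submonoid hull S \<noteq> \<Gamma>)"

definition fact_hom :: "('k::finite \<Rightarrow> nat ^ 'd) \<Rightarrow> nat ^ 'k \<Rightarrow> nat ^ 'd" where
  "fact_hom \<alpha> z = (\<Sum>j\<in>UNIV. z $ j *s \<alpha> j)"

definition factorizations :: "('k::finite \<Rightarrow> nat ^ 'd) \<Rightarrow> nat ^ 'd \<Rightarrow> (nat ^ 'k) set" where
  "factorizations \<alpha> \<gamma> = {z. fact_hom \<alpha> z = \<gamma>}"

definition fact_length :: "nat ^ 'k \<Rightarrow> nat" where
  "fact_length z = (\<Sum>j\<in>UNIV. z $ j)"

definition fact_gcd :: "nat ^ 'k \<Rightarrow> nat ^ 'k \<Rightarrow> nat ^ 'k" where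
  "fact_gcd z w = (\<chi> l. min (z $ l) (w $ l))"

text \<open>
  The truncated subtractions on \<open>nat\<close> below are genuine ones, since \<open>fact_gcd z w\<close> is
  componentwise below both arguments.
\<close>

definition fact_dist :: "nat ^ 'k \<Rightarrow> nat ^ 'k \<Rightarrow> nat" where
  "fact_dist z w =
     max (fact_length (z - fact_gcd z w)) (fact_length (w - fact_gcd z w))"

text \<open>
  Meaningful only for \<open>\<gamma>\<close> with \<open>\<gamma> - \<alpha> i\<close> in the semigroup; then \<open>N = \<infinity>\<close> always qualifies.
\<close>

definition tame_degree_at :: "('k::finite \<Rightarrow> nat ^ 'd) \<Rightarrow> 'k \<Rightarrow> nat ^ 'd \<Rightarrow> enat" where
  "tame_degree_at \<alpha> i \<gamma> =
     (LEAST N. \<forall>z\<in>factorizations \<alpha> \<gamma>. \<exists>w\<in>factorizations \<alpha> \<gamma>.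
        w $ i > 0 \<and> enat (fact_dist z w) \<le> N)"

text \<open>
  The condition \<open>\<alpha> i \<le> \<gamma>\<close> ensures that the truncated \<open>\<gamma> - \<alpha> i\<close> is the difference in
  \<open>\<int>\<^sup>d\<close>.
\<close>

definition tame_degree :: "(nat ^ 'd) set \<Rightarrow> ('k::finite \<Rightarrow> nat ^ 'd) \<Rightarrow> 'k \<Rightarrow> enat" where
  "tame_degree \<Gamma> \<alpha> i =
     Sup {tame_degree_at \<alpha> i \<gamma> | \<gamma>. \<gamma> \<in> \<Gamma> \<and> \<alpha> i \<le> \<gamma> \<and> \<gamma> - \<alpha> i \<in> \<Gamma>}"

definition minimals :: "'a::order set \<Rightarrow> 'a set" where
  "minimals A = {x\<in>A. \<forall>y\<in>A. y \<le> x \<longrightarrow> y = x}"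

definition principal_ideal :: "(nat ^ 'd) set \<Rightarrow> nat ^ 'd \<Rightarrow> (nat ^ 'd) set" where
  "principal_ideal \<Gamma> a = {a + \<beta> | \<beta>. \<beta> \<in> \<Gamma>}"

definition minimal_values :: "(nat ^ 'd) set \<Rightarrow> ('k::finite \<Rightarrow> nat ^ 'd) \<Rightarrow> 'k \<Rightarrow> (nat ^ 'd) set" where
  "minimal_values \<Gamma> \<alpha> i =
     {fact_hom \<alpha> x | x. x \<in> minimals (\<Union>\<gamma>\<in>principal_ideal \<Gamma> (\<alpha> i). factorizations \<alpha> \<gamma>)}"

end

theory Submission
  imports Defs
begin

text \<open>
  Any factorization \<open>z\<close> in \<open>Z(\<alpha>\<^sub>i + \<Gamma>)\<close> dominates a minimal one \<open>x\<close>. A factorization \<open>w\<close> of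
  \<open>\<phi>(x)\<close> with \<open>w\<^sub>i > 0\<close> lifts to the factorization \<open>w + (z - x)\<close> of \<open>\<phi>(z)\<close>, and translating
  both \<open>x\<close> and \<open>w\<close> by \<open>z - x\<close> leaves their distance unchanged.
\<close>

lemma fact_hom_add: "fact_hom \<alpha> (z + w) = fact_hom \<alpha> z + fact_hom \<alpha> w"
  by (simp add: fact_hom_def vec_eq_iff algebra_simps sum.distrib)

lemma fact_hom_axis: "fact_hom \<alpha> (axis j 1) = \<alpha> j"
proof -
  \<comment> \<open>Written as a conditional on \<open>l = j\<close>, the coordinate sum collapses
    to the single index \<open>j\<close>.\<close>
  have "(axis j (1::nat) $ l) * (\<alpha> l $ n) = (if l = j then \<alpha> j $ n else 0)" for l n
    by (simp add: axis_def)
  then show ?thesis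
    by (simp add: fact_hom_def vec_eq_iff)
qed

lemma is_submonoid_hull: "is_submonoid (is_submonoid hull S)"
  by (rule hull_in) (auto simp: is_submonoid_def)

lemma is_submonoid_range_fact_hom: "is_submonoid (range (fact_hom \<alpha>))"
proof -
  have "fact_hom \<alpha> 0 = 0"
    by (simp add: fact_hom_def vec_eq_iff)
  then show ?thesis
    unfolding is_submonoid_def by (force simp: image_iff simp flip: fact_hom_add)
qed

text \<open>The range of \<open>fact_hom \<alpha>\<close> is a submonoid containing every generator.
  Hence each element of the semigroup has a factorization.\<close>

lemma hull_range_subset_range_fact_hom:
  "is_submonoid hull range \<alpha> \<subseteq> range (fact_hom \<alpha>)"
proof (rule hull_minimal)
  show "range \<alpha> \<subseteq> range (fact_hom \<alpha>)"
    by (metis fact_hom_axis image_subsetI rangeI)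
qed (rule is_submonoid_range_fact_hom)

lemma fact_length_strict_mono:
  assumes "x < y"
  shows "fact_length x < fact_length y"
proof -
  from assms have "\<forall>l. x $ l \<le> y $ l" "\<exists>l. x $ l < y $ l"
    unfolding less_vec_def less_eq_vec_def by (auto simp: not_le)
  then show ?thesis
    unfolding fact_length_def by (intro sum_strict_mono_ex1) auto
qed

text \<open>Among the elements of \<open>A\<close> below \<open>z\<close>, one of least length is
  minimal: anything strictly below it would be strictly shorter.\<close>

lemma minimals_below:
  fixes z :: "nat ^ 'k"
  assumes "z \<in> A"
  obtains x where "x \<in> minimals A" "x \<le> z"
proof -
  obtain x where x: "x \<in> A" "x \<le> z"
    and least: "\<And>y. y \<in> A \<Longrightarrow> y \<le> z \<Longrightarrow> fact_length x \<le> fact_length y"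
    using assms ex_has_least_nat[of "\<lambda>y. y \<in> A \<and> y \<le> z" z fact_length] by auto
  have "y = x" if "y \<in> A" "y \<le> x" for y
    using least[of y] fact_length_strict_mono[of y x] that x by fastforce
  with x that show thesis
    by (auto simp: minimals_def)
qed

text \<open>The gcd moves along with the translation, so \<open>v\<close> cancels in both
  differences.\<close>

lemma fact_dist_translate: "fact_dist (z + v) (w + v) = fact_dist z w"
proof -
  have "fact_gcd (z + v) (w + v) = fact_gcd z w + v"
    by (simp add: fact_gcd_def vec_eq_iff min_add_distrib_left)
  then show ?thesis
    by (simp add: fact_dist_def fact_length_def)
qed

lemma tame_degree_at_le:
  assumes "\<And>z. z \<in> factorizations \<alpha> \<gamma> \<Longrightarrow>
    \<exists>w\<in>factorizations \<alpha> \<gamma>. w $ i > 0 \<and> enat (fact_dist z w) \<le> N"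
  shows "tame_degree_at \<alpha> i \<gamma> \<le> N"
  unfolding tame_degree_at_def using assms by (intro Least_le) blast

text \<open>The factorization \<open>w\<^sub>0\<close> makes \<infinity> an admissible bound, so the
  least bound exists in the well-order \<open>enat\<close> and is itself admissible.\<close>

lemma tame_degree_at_witness:
  assumes "z \<in> factorizations \<alpha> \<gamma>" "w\<^sub>0 \<in> factorizations \<alpha> \<gamma>" "w\<^sub>0 $ i > 0"
  obtains w where "w \<in> factorizations \<alpha> \<gamma>" "w $ i > 0"
    "enat (fact_dist z w) \<le> tame_degree_at \<alpha> i \<gamma>"
proof -
  have "\<forall>z\<in>factorizations \<alpha> \<gamma>. \<exists>w\<in>factorizations \<alpha> \<gamma>.
      w $ i > 0 \<and> enat (fact_dist z w) \<le> tame_degree_at \<alpha> i \<gamma>"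
    unfolding tame_degree_at_def
    by (rule LeastI[where k = \<infinity>]) (use assms(2,3) in auto)
  with assms(1) that show thesis by blast
qed

text \<open>Links the ideal to the subtraction in \<open>tame_degree\<close>:
  \<open>a \<le> \<gamma>\<close> makes the truncated difference exact.\<close>

lemma principal_ideal_iff:
  fixes a \<gamma> :: "nat ^ 'd"
  shows "\<gamma> \<in> principal_ideal \<Gamma> a \<longleftrightarrow> a \<le> \<gamma> \<and> \<gamma> - a \<in> \<Gamma>"
proof -
  have "\<gamma> = a + (\<gamma> - a)" if "a \<le> \<gamma>"
    using that by (simp add: vec_eq_iff less_eq_vec_def)
  moreover have "a \<le> a + \<beta>" "a + \<beta> - a = \<beta>" for \<beta>
    by (simp_all add: vec_eq_iff less_eq_vec_def)
  ultimately show ?thesis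
    unfolding principal_ideal_def by auto
qed

lemma principal_ideal_subset:
  assumes "affine_semigroup \<Gamma> \<alpha>"
  shows "principal_ideal \<Gamma> (\<alpha> i) \<subseteq> \<Gamma>"
proof -
  have "is_submonoid \<Gamma>" "range \<alpha> \<subseteq> \<Gamma>"
    using assms by (auto simp: affine_semigroup_def is_submonoid_hull hull_inc)
  then show ?thesis
    by (auto simp: is_submonoid_def principal_ideal_def)
qed

text \<open>Adding the unit vector at \<open>i\<close> to a factorization of
  \<open>\<gamma> - \<alpha> i\<close> gives the required \<open>w\<close>. It serves as the
  \<open>w\<^sub>0\<close> of \<open>tame_degree_at_witness\<close>.\<close>

lemma principal_ideal_factorization:
  assumes "affine_semigroup \<Gamma> \<alpha>" and "\<gamma> \<in> principal_ideal \<Gamma> (\<alpha> i)"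
  obtains w where "w \<in> factorizations \<alpha> \<gamma>" "w $ i > 0"
proof -
  from assms obtain u where "\<gamma> = \<alpha> i + fact_hom \<alpha> u"
    using hull_range_subset_range_fact_hom[of \<alpha>]
    by (auto simp: principal_ideal_def affine_semigroup_def)
  then have "axis i 1 + u \<in> factorizations \<alpha> \<gamma>"
    by (simp add: factorizations_def fact_hom_add fact_hom_axis del: One_nat_def)
  then show thesis
    by (rule that) simp
qed

lemma minimal_values_subset: "minimal_values \<Gamma> \<alpha> i \<subseteq> principal_ideal \<Gamma> (\<alpha> i)"
  by (auto simp: minimal_values_def minimals_def factorizations_def)

lemma tame_degree_at_le_Sup_minimal_values:
  assumes "affine_semigroup \<Gamma> \<alpha>" and "\<gamma> \<in> principal_ideal \<Gamma> (\<alpha> i)"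
  shows "tame_degree_at \<alpha> i \<gamma> \<le> Sup {tame_degree_at \<alpha> i \<gamma> | \<gamma>. \<gamma> \<in> minimal_values \<Gamma> \<alpha> i}"
    (is "_ \<le> ?S")
proof (rule tame_degree_at_le)
  fix z assume z: "z \<in> factorizations \<alpha> \<gamma>"
  with assms(2) obtain x
    where x: "x \<in> minimals (\<Union>\<gamma>\<in>principal_ideal \<Gamma> (\<alpha> i). factorizations \<alpha> \<gamma>)"
      and "x \<le> z"
    using minimals_below[of z "\<Union>\<gamma>\<in>principal_ideal \<Gamma> (\<alpha> i). factorizations \<alpha> \<gamma>"] by blast
  define v where "v = z - x"
  have z_eq: "z = x + v"
    using \<open>x \<le> z\<close> by (simp add: v_def vec_eq_iff less_eq_vec_def)
  have x_value: "fact_hom \<alpha> x \<in> minimal_values \<Gamma> \<alpha> i"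
    using x by (auto simp: minimal_values_def)
  \<comment> \<open>The value of \<open>x\<close> lies in the ideal, so the tame degree there is
    attained and can be applied to \<open>x\<close> itself.\<close>
  then obtain w\<^sub>0 where "w\<^sub>0 \<in> factorizations \<alpha> (fact_hom \<alpha> x)" "w\<^sub>0 $ i > 0"
    using minimal_values_subset principal_ideal_factorization[OF assms(1)] by blast
  then obtain w where w: "w \<in> factorizations \<alpha> (fact_hom \<alpha> x)" "w $ i > 0"
    and dist: "enat (fact_dist x w) \<le> tame_degree_at \<alpha> i (fact_hom \<alpha> x)"
    by (rule tame_degree_at_witness[rotated, of w\<^sub>0 \<alpha> _ i x]) (auto simp: factorizations_def)
  have "w + v \<in> factorizations \<alpha> \<gamma>"
    using w z by (simp add: factorizations_def z_eq fact_hom_add)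
  \<comment> \<open>Removing the common shift \<open>v\<close> leaves the distance of
    \<open>x\<close> and \<open>w\<close>, bounded by one member of the family under the
    supremum.\<close>
  moreover have "enat (fact_dist z (w + v)) \<le> ?S"
    unfolding z_eq fact_dist_translate
    using dist x_value by (intro Sup_upper2[of "tame_degree_at \<alpha> i (fact_hom \<alpha> x)"]) auto
  ultimately show "\<exists>w\<in>factorizations \<alpha> \<gamma>. w $ i > 0 \<and> enat (fact_dist z w) \<le> ?S"
    using w(2) by (intro bexI[of _ "w + v"]) auto
qed

theorem theorem5p2:
  fixes \<Gamma> :: "(nat ^ 'd) set" and \<alpha> :: "'k::finite \<Rightarrow> nat ^ 'd" and i :: 'k
  assumes "affine_semigroup \<Gamma> \<alpha>"
  shows "tame_degree \<Gamma> \<alpha> i = Sup {tame_degree_at \<alpha> i \<gamma> | \<gamma>. \<gamma> \<in> minimal_values \<Gamma> \<alpha> i}"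
proof -
  \<comment> \<open>The ideal lies inside \<Gamma>, so it is exactly the index set in the definition
    of the tame degree.\<close>
  have "tame_degree \<Gamma> \<alpha> i = Sup {tame_degree_at \<alpha> i \<gamma> | \<gamma>. \<gamma> \<in> principal_ideal \<Gamma> (\<alpha> i)}"
    unfolding tame_degree_def principal_ideal_iff[symmetric]
    using principal_ideal_subset[OF assms]
    by (intro arg_cong[where f = Sup] Collect_cong ex_cong1) blast
  also have "\<dots> = Sup {tame_degree_at \<alpha> i \<gamma> | \<gamma>. \<gamma> \<in> minimal_values \<Gamma> \<alpha> i}"
  proof (rule antisym)
    show "Sup {tame_degree_at \<alpha> i \<gamma> | \<gamma>. \<gamma> \<in> principal_ideal \<Gamma> (\<alpha> i)} \<le>
        Sup {tame_degree_at \<alpha> i \<gamma> | \<gamma>. \<gamma> \<in> minimal_values \<Gamma> \<alpha> i}"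
      using tame_degree_at_le_Sup_minimal_values[OF assms] by (intro Sup_least) auto
    \<comment> \<open>Minimal values lie in the ideal, so this is a supremum over a smaller
      family.\<close>
    show "Sup {tame_degree_at \<alpha> i \<gamma> | \<gamma>. \<gamma> \<in> minimal_values \<Gamma> \<alpha> i} \<le>
        Sup {tame_degree_at \<alpha> i \<gamma> | \<gamma>. \<gamma> \<in> principal_ideal \<Gamma> (\<alpha> i)}"
      using minimal_values_subset[of \<Gamma> \<alpha> i] by (intro Sup_subset_mono) auto
  qed
  finally show ?thesis .
qed

end
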